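(* Let $G$ be a group. For every $F,H\in M_n(\mathbb{C}G)$ and all representations $\pi,\pi'$ of $G$ of finite degree: (1) $\widehat{(F+H)}(\pi)=\widehat{F}(\pi)+\widehat{H}(\pi)$; (2) $\widehat{FH}(\pi)=\widehat{F}(\pi)\,\widehat{H}(\pi)$; (3) if $\pi\sim\pi'$ then the matrices $\widehat{F}(\pi)$ and $\widehat{F}(\pi')$ are similar; (4) $\widehat{F}(\pi\oplus\pi')$ is similar to $\widehat{F}(\pi)\oplus\widehat{F}(\pi')$. Moreover, if $\pi$ is unitary, then $\widehat{F^*}(\pi)=\widehat{F}(\pi)^*$.
   Context: $G$ is an arbitrary (finite or infinite) group. $\mathbb{C}G$ is the group algebra of finite $\mathbb{C}$-linear combinations $f=\sum_{x\in G}f_x x$, with involution $f^*=\sum_{x\in G}\overline{f_x}\,x^{-1}$. $M_n(\mathbb{C}G)$ is the algebra of $n\times n$ matrices over $\mathbb{C}G$, with product $(FH)_{i,j}=\sum_{k}F_{i,k}H_{k,j}$ and involution $(F^* )_{i,j}=(F_{j,i})^*$. For $F\in M_n(\mathbb{C}G)$ and $x\in G$, $F(x)\in M_n(\mathbb{C})$ is the matrix whose $(i,j)$ entry is the coefficient of $x$ in $F_{i,j}$. A representation of degree $k$ is a homomorphism $\pi\colon G\to GL_k(\mathbb{C})$; it is unitary if every $\pi(g)$ is a unitary matrix. $\pi\sim\pi'$ (equivalent, same degree $k$) means there is $S\in GL_k(\mathbb{C})$ with $\pi'(g)=S^{-1}\pi(g)S$ for all $g\in G$. $(\pi\oplus\pi')(g)=\pi(g)\oplus\pi'(g)$,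 where $\oplus$ of matrices is the block-diagonal direct sum. The Fourier transform of $F\in M_n(\mathbb{C}G)$ at a representation $\pi$ of degree $k$ is $\widehat{F}(\pi)=\sum_{x\in G}F(x)\otimes\pi(x)\in M_{nk}(\mathbb{C})$, with $\otimes$ the Kronecker product. For complex matrices, $^*$ is the Hermitian transpose. *)

theory Defs
  imports "HOL-Library.Poly_Mapping" "Jordan_Normal_Form.Schur_Decomposition"
begin

text \<open>
  The group is a type of class \<open>group_add\<close>, which is \<^emph>\<open>not\<close> assumed commutative: the group law
  is written \<open>x + y\<close>, the identity \<open>0\<close> and the inverse \<open>- x\<close>. The group algebra is then
  \<open>'g \<Rightarrow>\<^sub>0 complex\<close>, whose library multiplication is convolution, and matrices over it have the
  library's addition and multiplication.
\<close>

type_synonym 'g group_algebra = "'g \<Rightarrow>\<^sub>0 complex"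

definition ga_star :: "('g::group_add) group_algebra \<Rightarrow> 'g group_algebra" where
  "ga_star f = (\<Sum>x\<in>Poly_Mapping.keys f.
      Poly_Mapping.single (- x) (cnj (Poly_Mapping.lookup f x)))"

definition ga_mat_star :: "('g::group_add) group_algebra mat \<Rightarrow> 'g group_algebra mat" where
  "ga_mat_star F = mat (dim_col F) (dim_row F) (\<lambda>(i, j). ga_star (F $$ (j, i)))"

definition coeff_mat :: "'g group_algebra mat \<Rightarrow> 'g \<Rightarrow> complex mat" where
  "coeff_mat F x = map_mat (\<lambda>f. Poly_Mapping.lookup f x) F"

definition kronecker :: "complex mat \<Rightarrow> complex mat \<Rightarrow> complex mat" where
  "kronecker A B = mat (dim_row A * dim_row B) (dim_col A * dim_col B)
     (\<lambda>(i, j). A $$ (i div dim_row B, j div dim_col B) * B $$ (i mod dim_row B, j mod dim_col B))"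

definition direct_sum_mat :: "complex mat \<Rightarrow> complex mat \<Rightarrow> complex mat" where
  "direct_sum_mat A B =
     four_block_mat A (0\<^sub>m (dim_row A) (dim_col B)) (0\<^sub>m (dim_row B) (dim_col A)) B"

definition GL :: "nat \<Rightarrow> complex mat set" where
  "GL k = {A \<in> carrier_mat k k. invertible_mat A}"

definition representation :: "nat \<Rightarrow> ('g::group_add \<Rightarrow> complex mat) \<Rightarrow> bool" where
  "representation k \<pi> \<longleftrightarrow> (\<forall>g. \<pi> g \<in> GL k) \<and> (\<forall>g h. \<pi> (g + h) = \<pi> g * \<pi> h)"

definition unitary_mat :: "complex mat \<Rightarrow> bool" where
  "unitary_mat A \<longleftrightarrow> square_mat A \<and>
     mat_adjoint A * A = 1\<^sub>m (dim_row A) \<and> A * mat_adjoint A = 1\<^sub>m (dim_row A)"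

definition unitary_rep :: "('g::group_add \<Rightarrow> complex mat) \<Rightarrow> bool" where
  "unitary_rep \<pi> \<longleftrightarrow> (\<forall>g. unitary_mat (\<pi> g))"

text \<open>Below, \<open>T\<close> is the inverse of \<open>S\<close>; equivalent representations have the same degree.\<close>

definition equivalent_rep ::
    "nat \<Rightarrow> ('g::group_add \<Rightarrow> complex mat) \<Rightarrow> nat \<Rightarrow> ('g \<Rightarrow> complex mat) \<Rightarrow> bool" where
  "equivalent_rep k \<pi> k' \<pi>' \<longleftrightarrow> k' = k \<and>
     (\<exists>S\<in>GL k. \<exists>T\<in>GL k. S * T = 1\<^sub>m k \<and> T * S = 1\<^sub>m k \<and> (\<forall>g. \<pi>' g = T * \<pi> g * S))"

definition direct_sum_rep ::
    "('g::group_add \<Rightarrow> complex mat) \<Rightarrow> ('g \<Rightarrow> complex mat) \<Rightarrow> 'g \<Rightarrow> complex mat" where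
  "direct_sum_rep \<pi> \<pi>' g = direct_sum_mat (\<pi> g) (\<pi>' g)"

text \<open>
  The type of matrices of unspecified size is not an additive monoid, so the sum of matrices over
  the group is written entrywise. \<open>Sum_any\<close> sums over the whole group; only finitely many terms are
  nonzero, since the entries of \<open>F\<close> have finite support.
\<close>

definition fourier ::
    "('g::group_add) group_algebra mat \<Rightarrow> nat \<Rightarrow> ('g \<Rightarrow> complex mat) \<Rightarrow> complex mat" where
  "fourier F k \<pi> = mat (dim_row F * k) (dim_col F * k)
     (\<lambda>ij. Sum_any (\<lambda>x. kronecker (coeff_mat F x) (\<pi> x) $$ ij))"

end

theory Submission
  imports Defs
begin

text \<open>
  Up to the index arithmetic of Kronecker products, every claim is a statement about the linear
  extension \<open>f \<mapsto> \<Sum>\<^sub>x f\<^sub>x \<phi>(x)\<close> of a matrix coefficient \<open>\<phi>\<close> to the group algebra: the entry of the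
  Fourier transform at block \<open>(p, q)\<close>, position \<open>(a, b)\<close> is the value at \<open>F\<^sub>p\<^sub>q\<close> of the extension of
  \<open>x \<mapsto> \<pi>(x)\<^sub>a\<^sub>b\<close>. An equivalence \<open>S\<close> of representations conjugates the Fourier transforms by
  \<open>1 \<otimes> S\<close>, and the direct sum is handled by the permutation that moves the direct summand to the
  outermost index.
\<close>

section \<open>Linear extension to the group algebra\<close>

text \<open>The sum ranges over the whole group, as in \<open>fourier\<close>, so that the two match
  after unfolding. Finite support is used only when the sum is rewritten over a finite set.\<close>

definition linear_extension :: "('g \<Rightarrow> complex) \<Rightarrow> 'g group_algebra \<Rightarrow> complex" where
  "linear_extension \<phi> f = (\<Sum>x. Poly_Mapping.lookup f x * \<phi> x)"

text \<open>Cancellation can make the support of a sum smaller than the union of the supports.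
  Summing over one finite set that contains all of them puts \<open>f\<close>, \<open>h\<close> and
  \<open>f + h\<close> on the same footing.\<close>

lemma linear_extension_superset:
  assumes "finite A" "Poly_Mapping.keys f \<subseteq> A"
  shows "linear_extension \<phi> f = (\<Sum>x\<in>A. Poly_Mapping.lookup f x * \<phi> x)"
  unfolding linear_extension_def
  by (rule Sum_any.expand_superset) (use assms in \<open>auto simp: in_keys_iff\<close>)

lemma linear_extension_keys:
  "linear_extension \<phi> f = (\<Sum>x\<in>Poly_Mapping.keys f. Poly_Mapping.lookup f x * \<phi> x)"
  by (rule linear_extension_superset) auto

lemma linear_extension_zero [simp]: "linear_extension \<phi> 0 = 0"
  by (simp add: linear_extension_keys)

lemma linear_extension_add:
  "linear_extension \<phi> (f + h) = linear_extension \<phi> f + linear_extension \<phi> h"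
proof -
  let ?A = "Poly_Mapping.keys f \<union> Poly_Mapping.keys h"
  have "finite ?A" "Poly_Mapping.keys f \<subseteq> ?A" "Poly_Mapping.keys h \<subseteq> ?A"
    "Poly_Mapping.keys (f + h) \<subseteq> ?A"
    using Poly_Mapping.keys_add[of f h] by auto
  then show ?thesis
    by (simp add: linear_extension_superset[of ?A] lookup_add distrib_right sum.distrib)
qed

lemma linear_extension_sum:
  "linear_extension \<phi> (\<Sum>i\<in>I. f i) = (\<Sum>i\<in>I. linear_extension \<phi> (f i))"
  by (induction I rule: infinite_finite_induct) (auto simp: linear_extension_add)

lemma linear_extension_single [simp]:
  "linear_extension \<phi> (Poly_Mapping.single x c) = c * \<phi> x"
  by (simp add: linear_extension_keys)

lemma linear_extension_coeff_zero [simp]: "linear_extension (\<lambda>x. 0) f = 0"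
  by (simp add: linear_extension_keys)

lemma linear_extension_coeff_sum:
  "linear_extension (\<lambda>x. \<Sum>i\<in>I. \<phi> i x) f = (\<Sum>i\<in>I. linear_extension (\<phi> i) f)"
  by (simp add: linear_extension_keys sum_distrib_left sum.swap[of _ I])

lemma linear_extension_coeff_scale:
  "linear_extension (\<lambda>x. c * \<phi> x) f = c * linear_extension \<phi> f"
  "linear_extension (\<lambda>x. \<phi> x * c) f = linear_extension \<phi> f * c"
  by (simp_all add: linear_extension_keys sum_distrib_left sum_distrib_right mult_ac)

lemma sum_single_lookup:
  "(\<Sum>x\<in>Poly_Mapping.keys f. Poly_Mapping.single x (Poly_Mapping.lookup f x)) = f"
  by (rule poly_mapping_eqI)
     (auto simp: lookup_sum lookup_single when_def in_keys_iff)

text \<open>The hypothesis is the shape that multiplicativity of a representation gives to a matrix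
  coefficient, with \<open>c\<close> the inner index of the matrix product. Convolution is bilinear
  and multiplies point masses by adding their positions in order, so the rest is an exchange of
  finite sums.\<close>

lemma linear_extension_mult:
  fixes f h :: "('g::group_add) group_algebra"
  assumes "\<And>x y. \<phi> (x + y) = (\<Sum>c\<in>C. \<alpha> c x * \<beta> c y)"
  shows "linear_extension \<phi> (f * h) =
    (\<Sum>c\<in>C. linear_extension (\<alpha> c) f * linear_extension (\<beta> c) h)"
proof -
  let ?K = "Poly_Mapping.keys" and ?l = "Poly_Mapping.lookup"
  have "f * h = (\<Sum>x\<in>?K f. \<Sum>y\<in>?K h. Poly_Mapping.single (x + y) (?l f x * ?l h y))"
    using arg_cong2[OF sum_single_lookup[of f] sum_single_lookup[of h], of "(*)"]
    by (simp add: sum_product mult_single)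
  then have "linear_extension \<phi> (f * h) =
      (\<Sum>x\<in>?K f. \<Sum>y\<in>?K h. \<Sum>c\<in>C. (?l f x * \<alpha> c x) * (?l h y * \<beta> c y))"
    by (simp add: linear_extension_sum assms sum_distrib_left mult_ac)
  also have "\<dots> = (\<Sum>c\<in>C. \<Sum>x\<in>?K f. \<Sum>y\<in>?K h. (?l f x * \<alpha> c x) * (?l h y * \<beta> c y))"
    by (simp add: sum.swap[of _ C])
  finally show ?thesis
    by (simp add: linear_extension_keys sum_product)
qed

text \<open>The star is a sum of point masses at inverses with conjugated weights. Additivity of the
  extension evaluates it term by term, so its support need not be computed.\<close>

lemma linear_extension_star:
  "linear_extension \<phi> (ga_star f) = cnj (linear_extension (\<lambda>x. cnj (\<phi> (- x))) f)"
  by (simp add: ga_star_def linear_extension_sum) (simp add: linear_extension_keys)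

section \<open>Entries of matrices with block structure\<close>

lemma div_mod_less_mult:
  fixes i n k :: nat
  assumes "i < n * k"
  shows "i div k < n" "i mod k < k"
proof -
  have "k > 0" using assms by (cases k) auto
  then show "i div k < n" "i mod k < k"
    using assms by (auto simp: less_mult_imp_div_less)
qed

lemma block_index_less:
  fixes p a n k :: nat
  assumes "p < n" "a < k"
  shows "p * k + a < n * k"
proof -
  have "p * k + a < Suc p * k" using assms by simp
  also have "\<dots> \<le> n * k" using assms by (intro mult_le_mono1) simp
  finally show ?thesis .
qed

lemma sum_block_index:
  fixes f :: "nat \<Rightarrow> 'a::comm_monoid_add"
  shows "(\<Sum>i<n * k. f i) = (\<Sum>p<n. \<Sum>a<k. f (p * k + a))"
proof -
  have "(\<Sum>i = p * k..<p * k + k. f i) = (\<Sum>a<k. f (p * k + a))" for p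
    using sum.shift_bounds_nat_ivl[of f 0 "p * k" k] by (simp add: lessThan_atLeast0 add.commute)
  then show ?thesis by (simp flip: sum.nat_group)
qed

section \<open>Entries of products and adjoints\<close>

lemma index_mult_mat_sum:
  assumes "A \<in> carrier_mat n m" "B \<in> carrier_mat m l" "i < n" "j < l"
  shows "(A * B) $$ (i, j) = (\<Sum>c<m. A $$ (i, c) * B $$ (c, j))"
  using assms by (simp add: scalar_prod_def lessThan_atLeast0)

lemma index_triple_mult_mat_sum:
  assumes "A \<in> carrier_mat n m" "B \<in> carrier_mat m l" "C \<in> carrier_mat l r" "i < n" "j < r"
  shows "(A * B * C) $$ (i, j) = (\<Sum>d<l. \<Sum>c<m. A $$ (i, c) * B $$ (c, d) * C $$ (d, j))"
proof -
  have "A * B \<in> carrier_mat n l" using assms by auto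
  from index_mult_mat_sum[OF this assms(3-5)]
  have "(A * B * C) $$ (i, j) = (\<Sum>d<l. (A * B) $$ (i, d) * C $$ (d, j))" .
  also have "\<dots> = (\<Sum>d<l. (\<Sum>c<m. A $$ (i, c) * B $$ (c, d)) * C $$ (d, j))"
    by (intro sum.cong refl) (metis index_mult_mat_sum[OF assms(1,2,4)] lessThan_iff)
  finally show ?thesis by (simp only: sum_distrib_right)
qed

lemma index_mat_adjoint:
  fixes A :: "complex mat"
  assumes "i < dim_col A" "j < dim_row A"
  shows "mat_adjoint A $$ (i, j) = cnj (A $$ (j, i))"
  using assms by (simp add: mat_adjoint_def mat_of_rows_index)

section \<open>Kronecker products with an identity factor, and comparison by blocks\<close>

lemma kronecker_carrier [simp]:
  assumes "A \<in> carrier_mat n m" "B \<in> carrier_mat k l"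
  shows "kronecker A B \<in> carrier_mat (n * k) (m * l)"
  using assms by (simp add: kronecker_def)

text \<open>With the identity as left factor the Kronecker product is block diagonal, with
  \<open>n\<close> copies of \<open>S\<close>.\<close>

lemma index_kronecker_one:
  assumes "S \<in> carrier_mat k k" "p < n" "a < k" "q < n" "b < k"
  shows "kronecker (1\<^sub>m n) S $$ (p * k + a, q * k + b) = (if p = q then S $$ (a, b) else 0)"
  using assms block_index_less[of p n a k] block_index_less[of q n b k]
  by (simp add: kronecker_def)

lemma kronecker_one_one: "kronecker (1\<^sub>m n) (1\<^sub>m k) = 1\<^sub>m (n * k)"
proof (rule eq_matI)
  fix i j assume "i < dim_row (1\<^sub>m (n * k))" "j < dim_col (1\<^sub>m (n * k))"
  moreover have "i = j" if "i div k = j div k" "i mod k = j mod k"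
    using that by (metis div_mult_mod_eq)
  ultimately show "kronecker (1\<^sub>m n) (1\<^sub>m k) $$ (i, j) = 1\<^sub>m (n * k) $$ (i, j)"
    using div_mod_less_mult[of i n k] div_mod_less_mult[of j n k]
    by (auto simp: kronecker_def)
qed (auto simp: kronecker_def)

text \<open>Quotient and remainder by \<open>k\<close> write every flat index as
  \<open>p * k + a\<close>, so block coordinates reach all entries.\<close>

lemma eq_block_matI:
  assumes "A \<in> carrier_mat (n * k) (n * k)" "B \<in> carrier_mat (n * k) (n * k)"
    and "\<And>p a q b. p < n \<Longrightarrow> a < k \<Longrightarrow> q < n \<Longrightarrow> b < k \<Longrightarrow>
      A $$ (p * k + a, q * k + b) = B $$ (p * k + a, q * k + b)"
  shows "A = B"
proof (rule eq_matI)
  fix i j assume "i < dim_row B" "j < dim_col B"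
  then have "i < n * k" "j < n * k" using assms(2) by auto
  from assms(3)[OF div_mod_less_mult[OF this(1)] div_mod_less_mult[OF this(2)]]
  show "A $$ (i, j) = B $$ (i, j)" by simp
qed (use assms in auto)

lemma kronecker_one_mult:
  assumes "S \<in> carrier_mat k k" "T \<in> carrier_mat k k"
  shows "kronecker (1\<^sub>m n) S * kronecker (1\<^sub>m n) T = kronecker (1\<^sub>m n) (S * T)"
proof (rule eq_block_matI[of _ n k])
  fix p a q b assume *: "p < n" "a < k" "q < n" "b < k"
  have ST: "S * T \<in> carrier_mat k k" using assms by auto
  have "(kronecker (1\<^sub>m n) S * kronecker (1\<^sub>m n) T) $$ (p * k + a, q * k + b) =
    (\<Sum>r<n. \<Sum>c<k. kronecker (1\<^sub>m n) S $$ (p * k + a, r * k + c) *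
       kronecker (1\<^sub>m n) T $$ (r * k + c, q * k + b))"
    using assms * by (subst index_mult_mat_sum[of _ "n * k" "n * k" _ "n * k"])
      (auto simp: sum_block_index block_index_less)
  \<comment> \<open>Block diagonality of both factors kills every middle block except
    \<open>r = p = q\<close>.\<close>
  also have "\<dots> = (\<Sum>r<n. if p = r then if r = q then \<Sum>c<k. S $$ (a, c) * T $$ (c, b) else 0 else 0)"
    using * by (intro sum.cong refl)
      (auto simp: index_kronecker_one[OF assms(1)] index_kronecker_one[OF assms(2)])
  also have "\<dots> = kronecker (1\<^sub>m n) (S * T) $$ (p * k + a, q * k + b)"
    using * by (simp add: index_kronecker_one[OF ST] index_mult_mat_sum[OF assms] del: index_mult_mat)
  finally show "(kronecker (1\<^sub>m n) S * kronecker (1\<^sub>m n) T) $$ (p * k + a, q * k + b) =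
    kronecker (1\<^sub>m n) (S * T) $$ (p * k + a, q * k + b)" .
qed (use assms in \<open>auto intro!: mult_carrier_mat[of _ _ "n * k"] kronecker_carrier\<close>)

text \<open>Simultaneous reordering of rows and columns is conjugation by a permutation matrix:
  multiplying by \<open>P\<close> on the left applies \<sigma> to the row index, and multiplying by
  \<open>Q\<close> on the right applies it to the column index.\<close>

lemma similar_mat_permute:
  fixes A B :: "'a::semiring_1 mat"
  assumes A: "A \<in> carrier_mat N N" and B: "B \<in> carrier_mat N N"
    and inj: "inj_on \<sigma> {..<N}" and into: "\<And>i. i < N \<Longrightarrow> \<sigma> i < N"
    and AB: "\<And>i j. i < N \<Longrightarrow> j < N \<Longrightarrow> A $$ (i, j) = B $$ (\<sigma> i, \<sigma> j)"
  shows "similar_mat A B"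
proof -
  define P :: "'a mat" where "P = mat N N (\<lambda>(i, j). if j = \<sigma> i then 1 else 0)"
  define Q :: "'a mat" where "Q = mat N N (\<lambda>(i, j). if i = \<sigma> j then 1 else 0)"
  have P: "P \<in> carrier_mat N N" and Q: "Q \<in> carrier_mat N N" by (auto simp: P_def Q_def)
  have PX: "(P * X) $$ (i, j) = X $$ (\<sigma> i, j)"
    if "X \<in> carrier_mat N N" "i < N" "j < N" for X i j
  proof -
    have "(P * X) $$ (i, j) = (\<Sum>c<N. if c = \<sigma> i then X $$ (c, j) else 0)"
      unfolding index_mult_mat_sum[OF P that]
      by (intro sum.cong refl) (use that in \<open>auto simp: P_def\<close>)
    then show ?thesis using into[OF that(2)] by simp
  qed
  have XQ: "(X * Q) $$ (i, j) = X $$ (i, \<sigma> j)"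
    if "X \<in> carrier_mat N N" "i < N" "j < N" for X i j
  proof -
    have "(X * Q) $$ (i, j) = (\<Sum>c<N. if c = \<sigma> j then X $$ (i, c) else 0)"
      unfolding index_mult_mat_sum[OF that(1) Q that(2,3)]
      by (intro sum.cong refl) (use that in \<open>auto simp: Q_def\<close>)
    then show ?thesis using into[OF that(3)] by simp
  qed
  have PQ: "P * Q = 1\<^sub>m N"
  proof (rule eq_matI)
    fix i j assume "i < dim_row (1\<^sub>m N)" "j < dim_col (1\<^sub>m N)"
    then have ij: "i < N" "j < N" by auto
    then have "\<sigma> i = \<sigma> j \<longleftrightarrow> i = j" using inj by (simp add: inj_on_eq_iff)
    then show "(P * Q) $$ (i, j) = 1\<^sub>m N $$ (i, j)"
      unfolding PX[OF Q ij] using ij into by (simp add: Q_def)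
  qed (auto simp: P_def Q_def)
  \<comment> \<open>An injective self-map of a finite set is onto. The product \<open>Q * P\<close>
    requires this: row \<open>i\<close> of \<open>Q\<close> has its nonzero entry at the preimage of
    \<open>i\<close>.\<close>
  have surj: "\<sigma> ` {..<N} = {..<N}"
    using inj into by (intro endo_inj_surj) auto
  have QP: "Q * P = 1\<^sub>m N"
  proof (rule eq_matI)
    fix i j assume "i < dim_row (1\<^sub>m N)" "j < dim_col (1\<^sub>m N)"
    then have ij: "i < N" "j < N" by auto
    then obtain i' where i': "i' < N" "i = \<sigma> i'" using surj by (metis imageE lessThan_iff)
    have "(Q * P) $$ (i, j) = (\<Sum>c<N. if c = i' then if j = \<sigma> c then 1 else 0 else 0)"
      unfolding index_mult_mat_sum[OF Q P ij]
      by (intro sum.cong refl) (use ij i' inj in \<open>auto simp: Q_def P_def inj_on_def\<close>)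
    then show "(Q * P) $$ (i, j) = 1\<^sub>m N $$ (i, j)" using ij i' by auto
  qed (auto simp: P_def Q_def)
  have PB: "P * B \<in> carrier_mat N N" using P B by auto
  have "A = P * B * Q"
  proof (rule eq_matI)
    fix i j assume "i < dim_row (P * B * Q)" "j < dim_col (P * B * Q)"
    then have ij: "i < N" "j < N" using P Q by auto
    show "A $$ (i, j) = (P * B * Q) $$ (i, j)"
      unfolding XQ[OF PB ij] PX[OF B ij(1) into[OF ij(2)]] by (rule AB[OF ij])
  qed (use A P Q in auto)
  then show ?thesis
    using A B P Q PQ QP by (intro similar_matI[of _ _ P Q N]) auto
qed

section \<open>Representations\<close>

lemma representation_carrier:
  assumes "representation k \<pi>"
  shows "\<pi> x \<in> carrier_mat k k"
  using assms by (simp add: representation_def GL_def)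

text \<open>The image of the identity is idempotent and invertible, and multiplying the idempotent
  equation by an inverse leaves the identity matrix.\<close>

lemma representation_zero:
  assumes "representation k \<pi>"
  shows "\<pi> 0 = 1\<^sub>m k"
proof -
  have carrier: "\<pi> 0 \<in> carrier_mat k k" and "invertible_mat (\<pi> 0)"
    and idem: "\<pi> 0 = \<pi> 0 * \<pi> 0"
    using assms by (auto simp: representation_def GL_def) (metis add_0)
  then obtain T where T: "\<pi> 0 * T = 1\<^sub>m k" "T * \<pi> 0 = 1\<^sub>m (dim_row T)"
    by (auto simp: invertible_mat_def inverts_mat_def)
  \<comment> \<open>\<open>invertible_mat\<close> does not fix the size of the inverse; it is read
    off from the dimensions of the two products.\<close>
  have "T \<in> carrier_mat k k"
    using T carrier by (metis carrier_mat_triv carrier_matD(2) index_mult_mat(2,3) index_one_mat(2,3))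
  then show ?thesis
    using T idem carrier by (metis assoc_mult_mat carrier_matD(1) left_mult_one_mat)
qed

text \<open>The left side is a left inverse of \<open>\<pi> x\<close> and the adjoint is a right
  inverse, so associativity makes them equal.\<close>

lemma representation_uminus_unitary:
  assumes rep: "representation k \<pi>" and "unitary_rep \<pi>"
  shows "\<pi> (- x) = mat_adjoint (\<pi> x)"
proof -
  note carrier = representation_carrier[OF rep]
  have adj: "mat_adjoint (\<pi> x) \<in> carrier_mat k k"
    using carrier[of x] by (auto simp: mat_adjoint_def)
  have "\<pi> x * mat_adjoint (\<pi> x) = 1\<^sub>m k"
    using assms(2) carrier[of x] by (auto simp: unitary_rep_def unitary_mat_def)
  moreover have "\<pi> (- x) * \<pi> x = 1\<^sub>m k"
    using rep representation_zero[OF rep] by (metis representation_def left_minus)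
  ultimately show ?thesis
    using assoc_mult_mat[OF carrier[of "- x"] carrier[of x] adj]
      left_mult_one_mat[OF adj] right_mult_one_mat[OF carrier[of "- x"]] by simp
qed

section \<open>The Fourier transform\<close>

lemma fourier_carrier:
  assumes "F \<in> carrier_mat n n"
  shows "fourier F k \<pi> \<in> carrier_mat (n * k) (n * k)"
  using assms by (simp add: fourier_def)

text \<open>This is the bridge from matrices to linear extensions: division with remainder by
  \<open>k\<close> splits each flat index back into the block, which selects the entry of
  \<open>F\<close>, and the position, which selects the matrix coefficient.\<close>

lemma index_fourier:
  assumes "F \<in> carrier_mat n n" "\<And>x. \<pi> x \<in> carrier_mat k k"
    and "p < n" "a < k" "q < n" "b < k"
  shows "fourier F k \<pi> $$ (p * k + a, q * k + b) =
    linear_extension (\<lambda>x. \<pi> x $$ (a, b)) (F $$ (p, q))"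
proof -
  have "dim_row (\<pi> x) = k" "dim_col (\<pi> x) = k" for x using assms(2)[of x] by auto
  then show ?thesis
    using assms block_index_less[of p n a k] block_index_less[of q n b k]
    by (simp add: fourier_def linear_extension_def kronecker_def coeff_mat_def)
qed

lemma fourier_add:
  assumes F: "F \<in> carrier_mat n n" and H: "H \<in> carrier_mat n n"
    and \<pi>: "\<And>x. \<pi> x \<in> carrier_mat k k"
  shows "fourier (F + H) k \<pi> = fourier F k \<pi> + fourier H k \<pi>"
proof (rule eq_block_matI[of _ n k])
  have FH: "F + H \<in> carrier_mat n n" using F H by auto
  show "fourier (F + H) k \<pi> \<in> carrier_mat (n * k) (n * k)"
    "fourier F k \<pi> + fourier H k \<pi> \<in> carrier_mat (n * k) (n * k)"
    using fourier_carrier[OF FH] fourier_carrier[OF F] fourier_carrier[OF H] by auto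
  fix p a q b assume *: "p < n" "a < k" "q < n" "b < k"
  then show "fourier (F + H) k \<pi> $$ (p * k + a, q * k + b) =
      (fourier F k \<pi> + fourier H k \<pi>) $$ (p * k + a, q * k + b)"
    using F H fourier_carrier[OF H, of k \<pi>]
    by (simp add: index_fourier[OF FH \<pi>] index_fourier[OF F \<pi>] index_fourier[OF H \<pi>]
        block_index_less linear_extension_add)
qed

text \<open>The inner flat index of the product on the right splits into a block \<open>r\<close>,
  supplied by the product over the group algebra, and a position \<open>c\<close>, supplied by
  multiplicativity of \<pi>.\<close>

lemma fourier_mult:
  assumes F: "F \<in> carrier_mat n n" and H: "H \<in> carrier_mat n n"
    and rep: "representation k \<pi>"
  shows "fourier (F * H) k \<pi> = fourier F k \<pi> * fourier H k \<pi>"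
proof (rule eq_block_matI[of _ n k])
  note \<pi> = representation_carrier[OF rep]
  have FH: "F * H \<in> carrier_mat n n" using F H by auto
  show "fourier (F * H) k \<pi> \<in> carrier_mat (n * k) (n * k)"
    "fourier F k \<pi> * fourier H k \<pi> \<in> carrier_mat (n * k) (n * k)"
    by (rule fourier_carrier[OF FH],
        rule mult_carrier_mat[OF fourier_carrier[OF F] fourier_carrier[OF H]])
  fix p a q b assume *: "p < n" "a < k" "q < n" "b < k"
  have "\<pi> (x + y) $$ (a, b) = (\<Sum>c<k. \<pi> x $$ (a, c) * \<pi> y $$ (c, b))" for x y
    using rep index_mult_mat_sum[OF \<pi> \<pi> *(2,4)] by (simp add: representation_def)
  then have mult: "linear_extension (\<lambda>x. \<pi> x $$ (a, b)) (f * h) =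
      (\<Sum>c<k. linear_extension (\<lambda>x. \<pi> x $$ (a, c)) f * linear_extension (\<lambda>x. \<pi> x $$ (c, b)) h)"
    for f h
    by (rule linear_extension_mult)
  have "fourier (F * H) k \<pi> $$ (p * k + a, q * k + b) =
      (\<Sum>r<n. \<Sum>c<k. linear_extension (\<lambda>x. \<pi> x $$ (a, c)) (F $$ (p, r)) *
        linear_extension (\<lambda>x. \<pi> x $$ (c, b)) (H $$ (r, q)))"
    using * by (simp add: index_fourier[OF FH \<pi>] index_mult_mat_sum[OF F H] linear_extension_sum mult)
  also have "\<dots> = (\<Sum>i<n * k. fourier F k \<pi> $$ (p * k + a, i) * fourier H k \<pi> $$ (i, q * k + b))"
    using * by (simp add: sum_block_index index_fourier[OF F \<pi>] index_fourier[OF H \<pi>])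
  also have "\<dots> = (fourier F k \<pi> * fourier H k \<pi>) $$ (p * k + a, q * k + b)"
    using * by (simp add: index_mult_mat_sum[OF fourier_carrier[OF F] fourier_carrier[OF H]]
        block_index_less)
  finally show "fourier (F * H) k \<pi> $$ (p * k + a, q * k + b) =
    (fourier F k \<pi> * fourier H k \<pi>) $$ (p * k + a, q * k + b)" .
qed

text \<open>The matrices \<open>T\<close> and \<open>S\<close> are constant in \<open>x\<close>, so
  linearity in the matrix coefficient pulls their entries out of the extension. They act on
  positions inside blocks only, hence the identity factor.\<close>

lemma fourier_conjugate:
  assumes F: "F \<in> carrier_mat n n" and \<pi>: "\<And>x. \<pi> x \<in> carrier_mat k k"
    and S: "S \<in> carrier_mat k k" and T: "T \<in> carrier_mat k k"
  shows "fourier F k (\<lambda>x. T * \<pi> x * S) =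
    kronecker (1\<^sub>m n) T * fourier F k \<pi> * kronecker (1\<^sub>m n) S"
proof (rule eq_block_matI[of _ n k])
  have \<pi>': "T * \<pi> x * S \<in> carrier_mat k k" for x using \<pi>[of x] S T by auto
  note KT = kronecker_carrier[OF one_carrier_mat[of n] T]
  note KS = kronecker_carrier[OF one_carrier_mat[of n] S]
  note FF = fourier_carrier[OF F, of k \<pi>]
  show "fourier F k (\<lambda>x. T * \<pi> x * S) \<in> carrier_mat (n * k) (n * k)"
    "kronecker (1\<^sub>m n) T * fourier F k \<pi> * kronecker (1\<^sub>m n) S \<in> carrier_mat (n * k) (n * k)"
    using fourier_carrier[OF F] KT KS by auto
  fix p a q b assume *: "p < n" "a < k" "q < n" "b < k"
  let ?L = "\<lambda>c d. linear_extension (\<lambda>x. \<pi> x $$ (c, d))"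
  have "(kronecker (1\<^sub>m n) T * fourier F k \<pi> * kronecker (1\<^sub>m n) S) $$ (p * k + a, q * k + b) =
      (\<Sum>r<n. \<Sum>d<k. \<Sum>s<n. \<Sum>c<k. kronecker (1\<^sub>m n) T $$ (p * k + a, s * k + c) *
        fourier F k \<pi> $$ (s * k + c, r * k + d) * kronecker (1\<^sub>m n) S $$ (r * k + d, q * k + b))"
    using * by (simp add: index_triple_mult_mat_sum[OF KT FF KS] block_index_less sum_block_index)
  \<comment> \<open>The outer factors are block diagonal, which forces \<open>s = p\<close> and
    \<open>r = q\<close>.\<close>
  also have "\<dots> = (\<Sum>r<n. \<Sum>d<k. \<Sum>s<n. if s = p then if r = q then
      \<Sum>c<k. T $$ (a, c) * ?L c d (F $$ (s, r)) * S $$ (d, b) else 0 else 0)"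
    using * by (intro sum.cong refl)
      (auto simp: index_kronecker_one[OF T] index_kronecker_one[OF S] index_fourier[OF F \<pi>])
  also have "\<dots> = (\<Sum>r<n. if r = q then
      \<Sum>d<k. \<Sum>c<k. T $$ (a, c) * ?L c d (F $$ (p, r)) * S $$ (d, b) else 0)"
    using * by (intro sum.cong refl) auto
  also have "\<dots> = fourier F k (\<lambda>x. T * \<pi> x * S) $$ (p * k + a, q * k + b)"
    using * by (simp add: index_fourier[OF F \<pi>'] index_triple_mult_mat_sum[OF T \<pi> S]
        linear_extension_coeff_sum linear_extension_coeff_scale)
  finally show "fourier F k (\<lambda>x. T * \<pi> x * S) $$ (p * k + a, q * k + b) =
    (kronecker (1\<^sub>m n) T * fourier F k \<pi> * kronecker (1\<^sub>m n) S) $$ (p * k + a, q * k + b)" ..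
qed

lemma similar_fourier_equivalent:
  assumes F: "F \<in> carrier_mat n n" and rep: "representation k \<pi>"
    and "equivalent_rep k \<pi> k' \<pi>'"
  shows "similar_mat (fourier F k \<pi>) (fourier F k' \<pi>')"
proof -
  obtain S T where k: "k' = k" and S: "S \<in> carrier_mat k k" and T: "T \<in> carrier_mat k k"
    and ST: "S * T = 1\<^sub>m k" "T * S = 1\<^sub>m k" and \<pi>': "\<pi>' = (\<lambda>g. T * \<pi> g * S)"
    using assms(3) by (auto simp: equivalent_rep_def GL_def)
  let ?K = "kronecker (1\<^sub>m n)"
  \<comment> \<open>Equivalence expresses \<pi>' through \<pi>, so similarity arises in this
    direction and is reversed at the end.\<close>
  have "similar_mat (fourier F k \<pi>') (fourier F k \<pi>)"
  proof (rule similar_matI)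
    show "fourier F k \<pi>' = ?K T * fourier F k \<pi> * ?K S"
      unfolding \<pi>' by (rule fourier_conjugate[OF F representation_carrier[OF rep] S T])
    show "?K T * ?K S = 1\<^sub>m (n * k)" "?K S * ?K T = 1\<^sub>m (n * k)"
      using S T ST by (simp_all add: kronecker_one_mult kronecker_one_one)
    show "{fourier F k \<pi>', fourier F k \<pi>, ?K T, ?K S} \<subseteq> carrier_mat (n * k) (n * k)"
      using fourier_carrier[OF F] S T by auto
  qed
  then show ?thesis unfolding k by (rule similar_mat_sym)
qed

text \<open>On the left each of the \<open>n\<close> blocks lists the \<open>k\<close> coordinates
  of \<pi> and then the \<open>k'\<close> coordinates of \<pi>'. On the right all coordinates of
  \<pi> come first. The two matrices differ only by this reordering.\<close>

lemma similar_fourier_direct_sum: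
  assumes F: "F \<in> carrier_mat n n" and \<pi>: "\<And>x. \<pi> x \<in> carrier_mat k k"
    and \<pi>': "\<And>x. \<pi>' x \<in> carrier_mat k' k'"
  shows "similar_mat (fourier F (k + k') (direct_sum_rep \<pi> \<pi>'))
    (direct_sum_mat (fourier F k \<pi>) (fourier F k' \<pi>'))"
proof -
  let ?m = "k + k'" and ?N = "n * (k + k')"
  let ?D = "direct_sum_mat (fourier F k \<pi>) (fourier F k' \<pi>')"
  \<comment> \<open>The first \<open>n * k\<close> places hold the coordinates of \<pi>; those of
    \<pi>' follow, with \<open>a\<close> shifted down by \<open>k\<close> and the total offset by
    \<open>n * k\<close>. Then \<sigma> is the same map on flat indices with blocks of length
    \<open>k + k'\<close>.\<close>
  define \<tau> where "\<tau> p a = (if a < k then p * k + a else n * k + (p * k' + (a - k)))" for p a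
  define \<sigma> where "\<sigma> i = \<tau> (i div ?m) (i mod ?m)" for i
  have \<tau>_less: "\<tau> p a < ?N" if "p < n" "a < ?m" for p a
  proof (cases "a < k")
    case True
    then show ?thesis using that block_index_less[of p n a k] by (simp add: \<tau>_def distrib_left)
  next
    case False
    with that have "p * k' + (a - k) < n * k'" by (intro block_index_less) auto
    then show ?thesis
      using False by (simp only: \<tau>_def if_False distrib_left add_less_cancel_left)
  qed
  have \<tau>_inj: "p = q \<and> a = b"
    if "p < n" "a < ?m" "q < n" "b < ?m" and eq: "\<tau> p a = \<tau> q b" for p a q b
  proof -
    \<comment> \<open>Uniqueness of quotient and remainder, for a general length because it serves
      both \<open>k\<close> and \<open>k'\<close>. The mixed cases below are impossible: one value
      lies below \<open>n * k\<close> and the other does not.\<close>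
    have block: "p = q \<and> a = b" if "p * l + a = q * l + b" "a < l" "b < l" for p a q b l :: nat
      using that by (metis div_mult_self3 div_less add_0_right mod_mult_self3 mod_less not_less_zero)
    show ?thesis
    proof (cases "a < k"; cases "b < k")
      assume "a < k" "b < k"
      then show ?thesis using eq block[of p k a q b] by (simp add: \<tau>_def)
    next
      assume "a < k" "\<not> b < k"
      then show ?thesis using eq block_index_less[of p n a k] that by (simp add: \<tau>_def)
    next
      assume "\<not> a < k" "b < k"
      then show ?thesis using eq block_index_less[of q n b k] that by (simp add: \<tau>_def)
    next
      assume ab: "\<not> a < k" "\<not> b < k"
      then have "p * k' + (a - k) = q * k' + (b - k)"
        using eq by (simp only: \<tau>_def if_False add_left_cancel)
      then have "p = q \<and> a - k = b - k" by (rule block) (use ab that in auto)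
      then show ?thesis using ab by auto
    qed
  qed
  have rep: "direct_sum_rep \<pi> \<pi>' x \<in> carrier_mat ?m ?m" for x
    using \<pi>[of x] \<pi>'[of x] by (auto simp: direct_sum_rep_def direct_sum_mat_def)
  have entry: "fourier F ?m (direct_sum_rep \<pi> \<pi>') $$ (p * ?m + a, q * ?m + b) = ?D $$ (\<tau> p a, \<tau> q b)"
    if "p < n" "a < ?m" "q < n" "b < ?m" for p a q b
  proof -
    have dims: "dim_row (\<pi> x) = k" "dim_col (\<pi> x) = k" "dim_row (\<pi>' x) = k'" "dim_col (\<pi>' x) = k'"
      for x using \<pi>[of x] \<pi>'[of x] by auto
    have fdims: "dim_row (fourier F l \<rho>) = n * l" "dim_col (fourier F l \<rho>) = n * l" for l \<rho>
      using fourier_carrier[OF F, of l \<rho>] by auto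
    have "fourier F ?m (direct_sum_rep \<pi> \<pi>') $$ (p * ?m + a, q * ?m + b) =
      linear_extension (\<lambda>x. if a < k then if b < k then \<pi> x $$ (a, b) else 0
        else if b < k then 0 else \<pi>' x $$ (a - k, b - k)) (F $$ (p, q))"
      unfolding index_fourier[OF F rep that] using that
      by (simp add: direct_sum_rep_def direct_sum_mat_def dims cong: if_cong)
    also have "\<dots> = (if \<tau> p a < n * k
        then if \<tau> q b < n * k then fourier F k \<pi> $$ (\<tau> p a, \<tau> q b) else 0
        else if \<tau> q b < n * k then 0
        else fourier F k' \<pi>' $$ (\<tau> p a - n * k, \<tau> q b - n * k))"
      (is "_ = ?E")
    proof -
      \<comment> \<open>Being below \<open>n * k\<close> after reordering is the same as
        \<open>a < k\<close> before it, so the case distinctions on both sides agree. In the mixed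
        cases the coefficient of the direct sum is zero, and so is its extension.\<close>
      have low: "\<tau> r c = r * k + c" "\<tau> r c < n * k" if "c < k" "r < n" for r c
        using that by (simp_all add: \<tau>_def block_index_less)
      have high: "\<tau> r c - n * k = r * k' + (c - k)" "\<not> \<tau> r c < n * k" if "\<not> c < k" for r c
        unfolding \<tau>_def if_not_P[OF that] by simp_all
      have \<pi>_entry: "fourier F k \<pi> $$ (p * k + a, q * k + b) =
          linear_extension (\<lambda>x. \<pi> x $$ (a, b)) (F $$ (p, q))" if "a < k" "b < k"
        using \<open>p < n\<close> \<open>q < n\<close> that by (intro index_fourier[OF F \<pi>])
      have \<pi>'_entry: "fourier F k' \<pi>' $$ (p * k' + (a - k), q * k' + (b - k)) =
          linear_extension (\<lambda>x. \<pi>' x $$ (a - k, b - k)) (F $$ (p, q))" if "\<not> a < k" "\<not> b < k"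
        using \<open>p < n\<close> \<open>q < n\<close> \<open>a < ?m\<close> \<open>b < ?m\<close> that by (intro index_fourier[OF F \<pi>']) auto
      show ?thesis
        using \<open>p < n\<close> \<open>q < n\<close> \<pi>_entry \<pi>'_entry
        by (cases "a < k"; cases "b < k")
           (simp_all only: low high block_index_less if_True if_False
             linear_extension_coeff_zero simp_thms cong: if_cong)
    qed
    also have "?E = ?D $$ (\<tau> p a, \<tau> q b)"
      using \<tau>_less[of p a] \<tau>_less[of q b] that
      by (simp add: direct_sum_mat_def fdims distrib_left)
    finally show ?thesis .
  qed
  show ?thesis
  proof (rule similar_mat_permute[of _ ?N _ \<sigma>])
    show "fourier F ?m (direct_sum_rep \<pi> \<pi>') \<in> carrier_mat ?N ?N"
      by (rule fourier_carrier[OF F])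
    show "?D \<in> carrier_mat ?N ?N"
      using fourier_carrier[OF F, of k \<pi>] fourier_carrier[OF F, of k' \<pi>']
      by (auto simp: direct_sum_mat_def distrib_left)
    show "inj_on \<sigma> {..<?N}"
    proof (rule inj_onI)
      fix i j assume "i \<in> {..<?N}" "j \<in> {..<?N}" "\<sigma> i = \<sigma> j"
      then have "i div ?m = j div ?m \<and> i mod ?m = j mod ?m"
        unfolding \<sigma>_def by (intro \<tau>_inj) (auto simp: div_mod_less_mult)
      then show "i = j" by (metis div_mult_mod_eq)
    qed
    show "\<sigma> i < ?N" if "i < ?N" for i
      unfolding \<sigma>_def using div_mod_less_mult[OF that] by (rule \<tau>_less)
    show "fourier F ?m (direct_sum_rep \<pi> \<pi>') $$ (i, j) = ?D $$ (\<sigma> i, \<sigma> j)"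
      if "i < ?N" "j < ?N" for i j
      using entry[OF div_mod_less_mult[OF that(1)] div_mod_less_mult[OF that(2)]]
      by (simp only: \<sigma>_def div_mult_mod_eq)
  qed
qed

text \<open>The star of \<open>F\<close> swaps the blocks \<open>p\<close> and \<open>q\<close>,
  unitarity swaps the positions \<open>a\<close> and \<open>b\<close>, and the star in the group
  algebra supplies the conjugation; together these form the adjoint.\<close>

lemma fourier_star:
  assumes F: "F \<in> carrier_mat n n" and rep: "representation k \<pi>" and "unitary_rep \<pi>"
  shows "fourier (ga_mat_star F) k \<pi> = mat_adjoint (fourier F k \<pi>)"
proof (rule eq_block_matI[of _ n k])
  note \<pi> = representation_carrier[OF rep]
  note FF = fourier_carrier[OF F, of k \<pi>]
  have star: "ga_mat_star F \<in> carrier_mat n n" using F by (auto simp: ga_mat_star_def)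
  show "fourier (ga_mat_star F) k \<pi> \<in> carrier_mat (n * k) (n * k)"
    by (rule fourier_carrier[OF star])
  show "mat_adjoint (fourier F k \<pi>) \<in> carrier_mat (n * k) (n * k)"
    using FF by (auto simp: mat_adjoint_def)
  fix p a q b assume *: "p < n" "a < k" "q < n" "b < k"
  \<comment> \<open>This is the coefficient that \<open>linear_extension_star\<close> leaves inside
    the conjugation: the inverse turns into an adjoint, whose own conjugation cancels.\<close>
  have "cnj (\<pi> (- x) $$ (a, b)) = \<pi> x $$ (b, a)" for x
    using * \<pi>[of x] by (simp add: representation_uminus_unitary[OF rep assms(3)] index_mat_adjoint)
  moreover have "ga_mat_star F $$ (p, q) = ga_star (F $$ (q, p))"
    using * F by (simp add: ga_mat_star_def)
  ultimately show "fourier (ga_mat_star F) k \<pi> $$ (p * k + a, q * k + b) =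
      mat_adjoint (fourier F k \<pi>) $$ (p * k + a, q * k + b)"
    using * FF
    by (simp add: index_fourier[OF star \<pi>] index_mat_adjoint block_index_less
        index_fourier[OF F \<pi>] linear_extension_star)
qed

theorem proposition4:
  fixes F H :: "('g::group_add) group_algebra mat"
    and \<pi> \<pi>' :: "'g \<Rightarrow> complex mat"
    and n k k' :: nat
  assumes "F \<in> carrier_mat n n" and "H \<in> carrier_mat n n"
    and "representation k \<pi>" and "representation k' \<pi>'"
  shows "fourier (F + H) k \<pi> = fourier F k \<pi> + fourier H k \<pi>
    \<and> fourier (F * H) k \<pi> = fourier F k \<pi> * fourier H k \<pi>
    \<and> (equivalent_rep k \<pi> k' \<pi>' \<longrightarrow> similar_mat (fourier F k \<pi>) (fourier F k' \<pi>'))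
    \<and> similar_mat (fourier F (k + k') (direct_sum_rep \<pi> \<pi>'))
                  (direct_sum_mat (fourier F k \<pi>) (fourier F k' \<pi>'))
    \<and> (unitary_rep \<pi> \<longrightarrow> fourier (ga_mat_star F) k \<pi> = mat_adjoint (fourier F k \<pi>))"
  by (intro conjI impI fourier_add[OF assms(1,2)] fourier_mult[OF assms(1-3)]
      similar_fourier_equivalent[OF assms(1,3)] similar_fourier_direct_sum[OF assms(1)]
      fourier_star[OF assms(1,3)] representation_carrier[OF assms(3)]
      representation_carrier[OF assms(4)])

end
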